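(* On $\mathbb{C}^2\otimes\mathbb{C}^2\otimes\mathbb{C}^2$ (tensor symbols omitted) let $$S_1=ZZ\mathbb{I},\; S_2=Z\mathbb{I}\mathbb{I},\; S_3=\mathbb{I}X\mathbb{I},\; S_4=X\mathbb{I}\mathbb{I},\; S_5=XZX,\; S_6=YZZ,\; S_7=YYY.$$ Then these operators form a standard self-adjoint unitary representation (standard SAUR) of the anti-heptagon $\overline{C}_7$, and $\alpha(\overline{C}_7)=2$. Let $\rho=|v\rangle\langle v|$ be the state that corresponds to the largest eigenvector of $\sum_{i=1}^7 S_i$, i.e. $v$ is a unit eigenvector belonging to the largest eigenvalue. Then $$\sum_{i=1}^7\langle S_i\rangle_\rho^2=\frac{9+4\sqrt2}{7}\approx 2.09384>2=\alpha(\overline{C}_7).$$ Consequently the conjecture that $\sup_\rho\sum_i\langle S_i\rangle_\rho^2=\alpha(G)$ for the self-adjoint unitary representations $\{S_i\}$ of a graph $G$ is false.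
   Context: $X,Y,Z$ are the Pauli matrices, $\mathbb{I}$ is the identity, and e.g. $XZX=X\otimes Z\otimes X$. $\langle S\rangle_\rho=\operatorname{Tr}(\rho S)$. $\overline{C}_7$ is the complement of the cycle $1,2,\dots,7$: its vertex set is $\{1,\dots,7\}$, with $i\ne j$ adjacent iff $i-j\not\equiv\pm1\pmod 7$. $\alpha(G)$ is the independence number of $G$. Write $i\sim j$ for adjacency. A self-adjoint unitary representation (SAUR) of a graph $G$ is a family $\{S_i\}$ of self-adjoint operators, indexed by the vertices, with $S_i^2=\mathbb{I}$, $S_iS_j=-S_jS_i$ if $i\sim j$, and $S_iS_j=S_jS_i$ if $i\not\sim j$. A standard SAUR is defined recursively. If $G$ has no edge, assign $\mathbb{I}$ (or the number $1$) to every vertex. Otherwise choose an edge $(i_0,j_0)$ of $G$ and divide the other vertices $i$ into four groups: $V_0$ ($i\not\sim i_0$, $i\not\sim j_0$), $V_1$ ($i\not\sim i_0$, $i\sim j_0$), $V_2$ ($i\sim i_0$, $i\sim j_0$), $V_3$ ($i\sim i_0$, $i\not\sim j_0$). Let $G'$ be the graph on $V_0\cup V_1\cup V_2\cup V_3$ obtained from the induced subgraph of $G$ by reversing adjacency and non-adjacency between $i\in V_{k_1}$ and $j\in V_{k_2}$ for all $k_1\ne k_2$ in $\{1,2,3\}$, and leaving all other adjacencies unchanged. Given a standard SAUR $\{S'_i\}$ of $G'$, the following is a standard SAUR of $G$: assign $\sigma_k\otimes S'_i$ to each $i\in V_k$, $k=0,1,2,3$, where $\sigma_0=\mathbb{I},\sigma_1=X,\sigma_2=Y,\sigma_3=Z$;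 assign $X\otimes\mathbb{I}$ to $i_0$ and $Z\otimes\mathbb{I}$ to $j_0$. Different choices of edges may give different standard SAURs.
   Formalization: "Largest eigenvalue" is taken as the one of largest absolute value, here −(1+2√2); for the largest eigenvalue in the real order (≈3.494, two-dimensional eigenspace) the stated equality is false. *)

theory Defs
  imports
    "Jordan_Normal_Form.Schur_Decomposition"
    "Jordan_Normal_Form.Spectral_Radius"
    "HOL-Number_Theory.Cong"
begin

section \<open>Finite simple graphs\<close>

definition simple_graph :: "'a set \<Rightarrow> ('a \<Rightarrow> 'a \<Rightarrow> bool) \<Rightarrow> bool" where
  "simple_graph V adj \<longleftrightarrow>
     finite V \<and> (\<forall>i\<in>V. \<not> adj i i) \<and> (\<forall>i\<in>V. \<forall>j\<in>V. adj i j \<longrightarrow> adj j i)"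

definition independent_set :: "'a set \<Rightarrow> ('a \<Rightarrow> 'a \<Rightarrow> bool) \<Rightarrow> 'a set \<Rightarrow> bool" where
  "independent_set V adj I \<longleftrightarrow> I \<subseteq> V \<and> (\<forall>i\<in>I. \<forall>j\<in>I. \<not> adj i j)"

definition independence_number :: "'a set \<Rightarrow> ('a \<Rightarrow> 'a \<Rightarrow> bool) \<Rightarrow> nat" where
  "independence_number V adj = Max (card ` {I. independent_set V adj I})"

definition anti_heptagon :: "nat \<Rightarrow> nat \<Rightarrow> bool" where
  "anti_heptagon i j \<longleftrightarrow>
     i \<noteq> j \<and> \<not> [int i - int j = 1] (mod 7) \<and> \<not> [int i - int j = - 1] (mod 7)"


section \<open>Pauli matrices and tensor products\<close>

definition pauli_X :: "complex mat" where
  "pauli_X = mat_of_rows_list 2 [[0, 1], [1, 0]]"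

definition pauli_Y :: "complex mat" where
  "pauli_Y = mat_of_rows_list 2 [[0, - \<i>], [\<i>, 0]]"

definition pauli_Z :: "complex mat" where
  "pauli_Z = mat_of_rows_list 2 [[1, 0], [0, - 1]]"

definition pauli :: "nat \<Rightarrow> complex mat" where
  "pauli k = [1\<^sub>m 2, pauli_X, pauli_Y, pauli_Z] ! k"

definition tensor_mat :: "complex mat \<Rightarrow> complex mat \<Rightarrow> complex mat"  (infixr "\<otimes>\<^sub>m" 75) where
  "A \<otimes>\<^sub>m B = mat (dim_row A * dim_row B) (dim_col A * dim_col B)
     (\<lambda>(i, j). A $$ (i div dim_row B, j div dim_col B) * B $$ (i mod dim_row B, j mod dim_col B))"


section \<open>Self-adjoint unitary representations\<close>

definition SAUR :: "'a set \<Rightarrow> ('a \<Rightarrow> 'a \<Rightarrow> bool) \<Rightarrow> nat \<Rightarrow> ('a \<Rightarrow> complex mat) \<Rightarrow> bool" where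
  "SAUR V adj d S \<longleftrightarrow> 0 < d \<and>
     (\<forall>i\<in>V. S i \<in> carrier_mat d d \<and> mat_adjoint (S i) = S i \<and> S i * S i = 1\<^sub>m d) \<and>
     (\<forall>i\<in>V. \<forall>j\<in>V. (adj i j \<longrightarrow> S i * S j = - (S j * S i)) \<and> (\<not> adj i j \<longrightarrow> S i * S j = S j * S i))"

text \<open>The index \<open>k\<close> of the group \<open>V\<^sub>k\<close> containing \<open>i\<close>, relative to the chosen edge \<open>(i0, j0)\<close>.\<close>

definition edge_group :: "('a \<Rightarrow> 'a \<Rightarrow> bool) \<Rightarrow> 'a \<Rightarrow> 'a \<Rightarrow> 'a \<Rightarrow> nat" where
  "edge_group adj i0 j0 i =
     (if adj i i0 then (if adj i j0 then 2 else 3) else (if adj i j0 then 1 else 0))"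

definition reduced_adj ::
    "('a \<Rightarrow> 'a \<Rightarrow> bool) \<Rightarrow> 'a \<Rightarrow> 'a \<Rightarrow> 'a \<Rightarrow> 'a \<Rightarrow> bool" where
  "reduced_adj adj i0 j0 i j =
     (let k = edge_group adj i0 j0 i; l = edge_group adj i0 j0 j
      in if k \<in> {1, 2, 3} \<and> l \<in> {1, 2, 3} \<and> k \<noteq> l then \<not> adj i j else adj i j)"

text \<open>In the base case the identity may have any positive dimension; \<open>d = 1\<close> is the variant that
  assigns the number 1 to every vertex.\<close>

inductive standard_SAUR ::
    "'a set \<Rightarrow> ('a \<Rightarrow> 'a \<Rightarrow> bool) \<Rightarrow> nat \<Rightarrow> ('a \<Rightarrow> complex mat) \<Rightarrow> bool" where
  no_edge:
    "\<lbrakk> \<forall>i\<in>V. \<forall>j\<in>V. \<not> adj i j; 0 < d; \<forall>i\<in>V. S i = 1\<^sub>m d \<rbrakk> \<Longrightarrow> standard_SAUR V adj d S"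
| edge:
    "\<lbrakk> i0 \<in> V; j0 \<in> V; adj i0 j0;
       standard_SAUR (V - {i0, j0}) (reduced_adj adj i0 j0) d S';
       \<forall>i \<in> V - {i0, j0}. S i = pauli (edge_group adj i0 j0 i) \<otimes>\<^sub>m S' i;
       S i0 = pauli_X \<otimes>\<^sub>m 1\<^sub>m d; S j0 = pauli_Z \<otimes>\<^sub>m 1\<^sub>m d \<rbrakk>
     \<Longrightarrow> standard_SAUR V adj (2 * d) S"


section \<open>States and expectation values\<close>

definition mat_trace :: "complex mat \<Rightarrow> complex" where
  "mat_trace A = (\<Sum>i<dim_row A. A $$ (i, i))"

definition states :: "nat \<Rightarrow> complex mat set" where
  "states d = {\<rho> \<in> carrier_mat d d. mat_adjoint \<rho> = \<rho> \<and>
     (\<forall>v \<in> carrier_vec d. 0 \<le> Re ((\<rho> *\<^sub>v v) \<bullet>c v)) \<and> mat_trace \<rho> = 1}"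

definition pure_state :: "complex vec \<Rightarrow> complex mat" where
  "pure_state v = mat (dim_vec v) (dim_vec v) (\<lambda>(i, j). v $ i * cnj (v $ j))"

text \<open>For self-adjoint arguments the trace is real, see \<open>expval_eq_trace\<close> below.\<close>

definition expval :: "complex mat \<Rightarrow> complex mat \<Rightarrow> real" where
  "expval \<rho> A = Re (mat_trace (\<rho> * A))"

lemma self_adjoint_entry:
  assumes "A \<in> carrier_mat d d" "mat_adjoint A = A" "i < d" "j < d"
  shows "A $$ (i, j) = cnj (A $$ (j, i))"
proof -
  have "A $$ (i, j) = mat_adjoint A $$ (i, j)" using assms(2) by simp
  also have "\<dots> = cnj (A $$ (j, i))"
    using assms(1,3,4) unfolding mat_adjoint_def by (simp add: mat_of_rows_index)
  finally show ?thesis .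
qed

lemma expval_eq_trace:
  assumes \<rho>: "\<rho> \<in> carrier_mat d d" "mat_adjoint \<rho> = \<rho>"
    and A: "A \<in> carrier_mat d d" "mat_adjoint A = A"
  shows "complex_of_real (expval \<rho> A) = mat_trace (\<rho> * A)"
proof -
  have tr: "mat_trace (\<rho> * A) = (\<Sum>i<d. \<Sum>k<d. \<rho> $$ (i, k) * A $$ (k, i))"
    using \<rho>(1) A(1) by (simp add: mat_trace_def scalar_prod_def atLeast0LessThan)
  have "cnj (mat_trace (\<rho> * A)) = (\<Sum>i<d. \<Sum>k<d. cnj (\<rho> $$ (i, k)) * cnj (A $$ (k, i)))"
    by (simp add: tr)
  also have "\<dots> = (\<Sum>i<d. \<Sum>k<d. \<rho> $$ (k, i) * A $$ (i, k))"
  proof (intro sum.cong refl)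
    fix i k assume "i \<in> {..<d}" "k \<in> {..<d}"
    then have "i < d" "k < d" by auto
    then show "cnj (\<rho> $$ (i, k)) * cnj (A $$ (k, i)) = \<rho> $$ (k, i) * A $$ (i, k)"
      by (simp only: self_adjoint_entry[OF \<rho>, of k i] self_adjoint_entry[OF A, of i k])
  qed
  also have "\<dots> = mat_trace (\<rho> * A)"
    unfolding tr by (rule sum.swap)
  finally show ?thesis
    by (simp add: expval_def complex_eq_iff)
qed

text \<open>The largest eigenvalue is the one of largest absolute value. For the seven operators
  considered here it is negative and simple; the maximum of the spectrum in the order of the
  reals is a different, degenerate eigenvalue.\<close>

definition largest_eigenvector :: "complex mat \<Rightarrow> complex vec \<Rightarrow> bool" where
  "largest_eigenvector A v \<longleftrightarrow> (\<exists>k. eigenvector A v k \<and> cmod k = spectral_radius A)"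

end

theory Submission
  imports Defs
begin

text \<open>The characteristic polynomial of \<open>H = S\<^sub>1 + \<dots> + S\<^sub>7\<close> is
  \<open>(x\<^sup>2 + 2 x - 7) (x\<^sup>3 - x\<^sup>2 - 9 x + 1)\<^sup>2\<close>. The roots of the cubic have modulus less than
  \<open>1 + 2 \<surd>2\<close>, so the eigenvalue of largest modulus is the simple one \<open>\<mu> = - (1 + 2 \<surd>2)\<close>. On its
  eigenvector all seven operators have the same expectation, which is therefore \<open>\<mu> / 7\<close>, and the sum of
  the squares is \<open>\<mu>\<^sup>2 / 7\<close>.

  A standard SAUR is a SAUR because \<open>i\<^sub>0\<close> and \<open>j\<^sub>0\<close> are isolated in the reduced graph: every \<open>S\<^sub>i\<close> is
  the Pauli matrix of its group tensored with an operator of a SAUR of the reduced graph, and the Pauli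
  factor anticommutes exactly where adjacency was reversed.\<close>

section \<open>Tensor products and Pauli matrices\<close>

text \<open>The range below \<open>m * n\<close> is cut into \<open>m\<close> consecutive blocks of
  length \<open>n\<close>; the block number and the position within the block are the two indices of
  a tensor factorisation.\<close>

lemma sum_div_mod:
  fixes f :: "nat \<Rightarrow> nat \<Rightarrow> 'a::comm_monoid_add"
  shows "(\<Sum>k<m * n. f (k div n) (k mod n)) = (\<Sum>i<m. \<Sum>j<n. f i j)"
proof -
  have "(\<Sum>k<m * n. f (k div n) (k mod n)) = (\<Sum>i<m. \<Sum>k=i*n..<i*n+n. f (k div n) (k mod n))"
    by (rule sum.nat_group[symmetric])
  also have "\<dots> = (\<Sum>i<m. \<Sum>j<n. f i j)"
  proof (rule sum.cong[OF refl])
    fix i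
    have "(\<Sum>k=i*n..<i*n+n. f (k div n) (k mod n)) = (\<Sum>j=0..<n. f ((j+i*n) div n) ((j+i*n) mod n))"
      using sum.shift_bounds_nat_ivl[of "\<lambda>k. f (k div n) (k mod n)" 0 "i*n" n] by (simp add: add.commute)
    also have "\<dots> = (\<Sum>j<n. f i j)"
      by (intro sum.cong) auto
    finally show "(\<Sum>k=i*n..<i*n+n. f (k div n) (k mod n)) = (\<Sum>j<n. f i j)" .
  qed
  finally show ?thesis .
qed

lemma tensor_mat_carrier [simp]:
  assumes "A \<in> carrier_mat m n" "B \<in> carrier_mat p q"
  shows "A \<otimes>\<^sub>m B \<in> carrier_mat (m * p) (n * q)"
  using assms by (auto simp: tensor_mat_def)

lemma tensor_mat_index:
  assumes "A \<in> carrier_mat m n" "B \<in> carrier_mat p q" "i < m * p" "j < n * q"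
  shows "(A \<otimes>\<^sub>m B) $$ (i, j) = A $$ (i div p, j div q) * B $$ (i mod p, j mod q)"
  using assms by (auto simp: tensor_mat_def)

text \<open>The mixed-product rule. The inner summation index splits into quotient and remainder,
  after which the double sum is a product of two sums, one for each factor.\<close>

lemma tensor_mat_mult:
  assumes A: "A \<in> carrier_mat m n" and B: "B \<in> carrier_mat p q"
    and C: "C \<in> carrier_mat n r" and D: "D \<in> carrier_mat q s"
  shows "(A \<otimes>\<^sub>m B) * (C \<otimes>\<^sub>m D) = (A * C) \<otimes>\<^sub>m (B * D)"
proof (rule eq_matI)
  fix i j assume "i < dim_row ((A * C) \<otimes>\<^sub>m (B * D))" "j < dim_col ((A * C) \<otimes>\<^sub>m (B * D))"
  then have i: "i < m * p" and j: "j < r * s"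
    using assms by (auto simp: tensor_mat_def)
  \<comment> \<open>An index below a product exists only if no dimension is zero, which gives the
    bounds on quotients and remainders.\<close>
  then have pos: "0 < p" "0 < s" by (auto intro!: Nat.gr0I)
  have lt: "i div p < m" "i mod p < p" "j div s < r" "j mod s < s"
    using i j pos by (auto simp: less_mult_imp_div_less)
  have "((A \<otimes>\<^sub>m B) * (C \<otimes>\<^sub>m D)) $$ (i, j) =
      (\<Sum>k<n * q. (A \<otimes>\<^sub>m B) $$ (i, k) * (C \<otimes>\<^sub>m D) $$ (k, j))"
    using tensor_mat_carrier[OF A B] tensor_mat_carrier[OF C D] i j
    by (auto simp: scalar_prod_def atLeast0LessThan)
  also have "\<dots> = (\<Sum>k<n * q. (A $$ (i div p, k div q) * B $$ (i mod p, k mod q)) *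
      (C $$ (k div q, j div s) * D $$ (k mod q, j mod s)))"
    using i j by (intro sum.cong refl) (simp add: tensor_mat_index[OF A B] tensor_mat_index[OF C D])
  also have "\<dots> = (\<Sum>k<n. \<Sum>l<q. (A $$ (i div p, k) * B $$ (i mod p, l)) *
      (C $$ (k, j div s) * D $$ (l, j mod s)))"
    by (rule sum_div_mod)
  also have "\<dots> = (\<Sum>k<n. A $$ (i div p, k) * C $$ (k, j div s)) *
      (\<Sum>l<q. B $$ (i mod p, l) * D $$ (l, j mod s))"
    by (simp add: sum_product mult_ac)
  also have "\<dots> = ((A * C) \<otimes>\<^sub>m (B * D)) $$ (i, j)"
    using assms lt i j
    by (subst tensor_mat_index[of _ m r _ p s]) (auto simp: scalar_prod_def atLeast0LessThan)
  finally show "((A \<otimes>\<^sub>m B) * (C \<otimes>\<^sub>m D)) $$ (i, j) = ((A * C) \<otimes>\<^sub>m (B * D)) $$ (i, j)" .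
qed (use assms in \<open>auto simp: tensor_mat_def\<close>)

lemma mat_adjoint_carrier [simp]:
  assumes "(A :: complex mat) \<in> carrier_mat m n"
  shows "mat_adjoint A \<in> carrier_mat n m"
  using assms by (auto simp: mat_adjoint_def)

lemma mat_adjoint_index:
  assumes "(A :: complex mat) \<in> carrier_mat m n" "i < n" "j < m"
  shows "mat_adjoint A $$ (i, j) = cnj (A $$ (j, i))"
  using assms by (simp add: mat_adjoint_def mat_of_rows_index)

lemma mat_adjoint_eqI:
  assumes A: "(A :: complex mat) \<in> carrier_mat n n"
    and "\<And>i j. i < n \<Longrightarrow> j < n \<Longrightarrow> cnj (A $$ (j, i)) = A $$ (i, j)"
  shows "mat_adjoint A = A"
  using assms(2) carrier_matD[OF A] carrier_matD[OF mat_adjoint_carrier[OF A]]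
  by (intro eq_matI) (auto simp: mat_adjoint_index[OF A])

lemma mat_adjoint_tensor_mat:
  assumes A: "A \<in> carrier_mat m n" and B: "B \<in> carrier_mat p q"
  shows "mat_adjoint (A \<otimes>\<^sub>m B) = mat_adjoint A \<otimes>\<^sub>m mat_adjoint B"
proof (rule eq_matI)
  note AB = tensor_mat_carrier[OF A B]
  note AB' = tensor_mat_carrier[OF mat_adjoint_carrier[OF A] mat_adjoint_carrier[OF B]]
  fix i j assume "i < dim_row (mat_adjoint A \<otimes>\<^sub>m mat_adjoint B)"
    "j < dim_col (mat_adjoint A \<otimes>\<^sub>m mat_adjoint B)"
  then have i: "i < n * q" and j: "j < m * p" using AB' by auto
  then have pos: "0 < p" "0 < q" by (auto intro!: Nat.gr0I)
  have lt: "i div q < n" "i mod q < q" "j div p < m" "j mod p < p"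
    using i j pos by (auto simp: less_mult_imp_div_less)
  show "mat_adjoint (A \<otimes>\<^sub>m B) $$ (i, j) = (mat_adjoint A \<otimes>\<^sub>m mat_adjoint B) $$ (i, j)"
    using i j lt
    by (simp add: mat_adjoint_index[OF AB] tensor_mat_index[OF A B] mat_adjoint_index[OF A]
        mat_adjoint_index[OF B]
        tensor_mat_index[OF mat_adjoint_carrier[OF A] mat_adjoint_carrier[OF B]])
next
  note AB = tensor_mat_carrier[OF A B]
  note AB' = tensor_mat_carrier[OF mat_adjoint_carrier[OF A] mat_adjoint_carrier[OF B]]
  show "dim_row (mat_adjoint (A \<otimes>\<^sub>m B)) = dim_row (mat_adjoint A \<otimes>\<^sub>m mat_adjoint B)"
    using mat_adjoint_carrier[OF AB] AB' by auto
  show "dim_col (mat_adjoint (A \<otimes>\<^sub>m B)) = dim_col (mat_adjoint A \<otimes>\<^sub>m mat_adjoint B)"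
    using mat_adjoint_carrier[OF AB] AB' by auto
qed

lemma tensor_mat_smult:
  assumes "A \<in> carrier_mat m n" "B \<in> carrier_mat p q"
  shows "(a \<cdot>\<^sub>m A) \<otimes>\<^sub>m (b \<cdot>\<^sub>m B) = (a * b) \<cdot>\<^sub>m (A \<otimes>\<^sub>m B)"
proof (rule eq_matI)
  fix i j assume "i < dim_row ((a * b) \<cdot>\<^sub>m (A \<otimes>\<^sub>m B))" "j < dim_col ((a * b) \<cdot>\<^sub>m (A \<otimes>\<^sub>m B))"
  then have i: "i < m * p" and j: "j < n * q" using assms by (auto simp: tensor_mat_def)
  then have pos: "0 < p" "0 < q" by (auto intro!: Nat.gr0I)
  have lt: "i div p < m" "i mod p < p" "j div q < n" "j mod q < q"
    using i j pos by (auto simp: less_mult_imp_div_less)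
  show "((a \<cdot>\<^sub>m A) \<otimes>\<^sub>m (b \<cdot>\<^sub>m B)) $$ (i, j) = ((a * b) \<cdot>\<^sub>m (A \<otimes>\<^sub>m B)) $$ (i, j)"
    using assms i j lt by (auto simp: tensor_mat_def)
qed (use assms in \<open>auto simp: tensor_mat_def\<close>)

lemma tensor_mat_one: "1\<^sub>m m \<otimes>\<^sub>m 1\<^sub>m n = 1\<^sub>m (m * n)"
proof (rule eq_matI)
  fix i j assume "i < dim_row (1\<^sub>m (m * n))" "j < dim_col (1\<^sub>m (m * n))"
  then have i: "i < m * n" and j: "j < m * n" by auto
  then have pos: "0 < n" by (auto intro!: Nat.gr0I)
  have lt: "i div n < m" "i mod n < n" "j div n < m" "j mod n < n"
    using i j pos by (auto simp: less_mult_imp_div_less)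
  have "i = j \<longleftrightarrow> i div n = j div n \<and> i mod n = j mod n"
    by (metis div_mult_mod_eq)
  then show "(1\<^sub>m m \<otimes>\<^sub>m 1\<^sub>m n) $$ (i, j) = 1\<^sub>m (m * n) $$ (i, j)"
    using i j lt by (auto simp: tensor_mat_def)
qed (auto simp: tensor_mat_def)

text \<open>Used at the innermost stage of the recursion, where the base representation has
  dimension 1.\<close>

lemma tensor_mat_one_right: "A \<otimes>\<^sub>m 1\<^sub>m (Suc 0) = A"
  by (rule eq_matI) (auto simp: tensor_mat_def)

section \<open>Pauli matrices\<close>

lemma pauli_simps [simp]:
  "pauli 0 = 1\<^sub>m 2" "pauli 1 = pauli_X" "pauli (Suc 0) = pauli_X" "pauli 2 = pauli_Y" "pauli 3 = pauli_Z"
  by (simp_all add: pauli_def)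

lemma pauli_carrier [simp]:
  "pauli_X \<in> carrier_mat 2 2" "pauli_Y \<in> carrier_mat 2 2" "pauli_Z \<in> carrier_mat 2 2"
  by (auto simp: pauli_X_def pauli_Y_def pauli_Z_def mat_of_rows_list_def)

lemma pauli_dim [simp]:
  "dim_row pauli_X = 2" "dim_row pauli_Y = 2" "dim_row pauli_Z = 2"
  "dim_col pauli_X = 2" "dim_col pauli_Y = 2" "dim_col pauli_Z = 2"
  by (auto simp: pauli_X_def pauli_Y_def pauli_Z_def mat_of_rows_list_def)

lemma pauli_index [simp]:
  "pauli_X $$ (0, 0) = 0" "pauli_X $$ (0, Suc 0) = 1" "pauli_X $$ (Suc 0, 0) = 1" "pauli_X $$ (Suc 0, Suc 0) = 0"
  "pauli_Y $$ (0, 0) = 0" "pauli_Y $$ (0, Suc 0) = - \<i>" "pauli_Y $$ (Suc 0, 0) = \<i>" "pauli_Y $$ (Suc 0, Suc 0) = 0"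
  "pauli_Z $$ (0, 0) = 1" "pauli_Z $$ (0, Suc 0) = 0" "pauli_Z $$ (Suc 0, 0) = 0" "pauli_Z $$ (Suc 0, Suc 0) = - 1"
  by (simp_all add: pauli_X_def pauli_Y_def pauli_Z_def mat_of_rows_list_def)

lemma mat_2_eqI:
  assumes "A \<in> carrier_mat 2 2" "B \<in> carrier_mat 2 2"
    and "A $$ (0, 0) = B $$ (0, 0)" "A $$ (0, Suc 0) = B $$ (0, Suc 0)"
    and "A $$ (Suc 0, 0) = B $$ (Suc 0, 0)" "A $$ (Suc 0, Suc 0) = B $$ (Suc 0, Suc 0)"
  shows "A = B"
  using assms by (intro eq_matI) (auto simp: less_2_cases_iff)

lemma mat_2_mult_carrier: "A \<in> carrier_mat 2 2 \<Longrightarrow> B \<in> carrier_mat 2 2 \<Longrightarrow> A * B \<in> carrier_mat 2 2"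
  by (rule mult_carrier_mat)

lemma mat_2_mult_index:
  assumes "A \<in> carrier_mat 2 2" "B \<in> carrier_mat 2 2" "i < 2" "j < 2"
  shows "(A * B) $$ (i, j) = A $$ (i, 0) * B $$ (0, j) + A $$ (i, Suc 0) * B $$ (Suc 0, j)"
  using assms by (simp add: scalar_prod_def numeral_2_eq_2)

lemma less_four_cases:
  assumes "(k::nat) < 4"
  obtains "k = 0" | "k = 1" | "k = 2" | "k = 3"
  using assms by linarith

lemma pauli_self_adjoint:
  assumes "k < 4"
  shows "pauli k \<in> carrier_mat 2 2" "mat_adjoint (pauli k) = pauli k" "pauli k * pauli k = 1\<^sub>m 2"
proof -
  show c: "pauli k \<in> carrier_mat 2 2"
    using assms by (cases rule: less_four_cases) auto
  show "mat_adjoint (pauli k) = pauli k"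
    using assms by (cases rule: less_four_cases)
      (rule mat_2_eqI; simp add: mat_adjoint_index[where m = 2 and n = 2])+
  show "pauli k * pauli k = 1\<^sub>m 2"
    using assms by (cases rule: less_four_cases)
      (rule mat_2_eqI; simp add: mat_2_mult_carrier mat_2_mult_index del: index_mult_mat(1))+
qed

text \<open>The condition on \<open>k\<close> and \<open>l\<close> has the form of the reversal
  condition in \<open>reduced_adj\<close>, so the sign found here cancels a reversal of
  adjacency.\<close>

lemma pauli_commute:
  assumes "k < 4" "l < 4"
  shows "pauli k * pauli l =
    (if k \<in> {1, 2, 3} \<and> l \<in> {1, 2, 3} \<and> k \<noteq> l then - 1 else 1) \<cdot>\<^sub>m (pauli l * pauli k)"
  by (rule less_four_cases[OF assms(1)]; rule less_four_cases[OF assms(2)]; hypsubst; rule mat_2_eqI;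
      simp add: mat_2_mult_carrier mat_2_mult_index del: index_mult_mat(1))

section \<open>Standard representations are representations\<close>

lemma smult_minus_one_mat: "(- 1) \<cdot>\<^sub>m A = - (A :: complex mat)"
  by (rule eq_matI) auto

lemma smult_one_mat: "1 \<cdot>\<^sub>m A = (A :: complex mat)"
  by (rule eq_matI) auto

lemma smult_smult_mat: "a \<cdot>\<^sub>m (b \<cdot>\<^sub>m A) = (a * b) \<cdot>\<^sub>m (A :: complex mat)"
  by (rule eq_matI) auto

text \<open>With commuting and anticommuting merged into one equation with a sign, the relations of
  a tensor product follow by multiplying the signs of its factors.\<close>

lemma SAUR_iff_sign:
  "SAUR V adj d S \<longleftrightarrow> 0 < d \<and>
     (\<forall>i\<in>V. S i \<in> carrier_mat d d \<and> mat_adjoint (S i) = S i \<and> S i * S i = 1\<^sub>m d) \<and>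
     (\<forall>i\<in>V. \<forall>j\<in>V. S i * S j = (if adj i j then - 1 else 1) \<cdot>\<^sub>m (S j * S i))"
  by (auto simp: SAUR_def smult_minus_one_mat smult_one_mat)

lemma edge_group_less: "edge_group adj i0 j0 i < 4"
  by (simp add: edge_group_def)

lemma mat_adjoint_one: "mat_adjoint (1\<^sub>m n :: complex mat) = 1\<^sub>m n"
  by (rule eq_matI) (auto simp: mat_adjoint_def mat_of_rows_index)

text \<open>Reversal depends symmetrically on the two vertices and never affects a vertex paired
  with itself, since it requires different groups.\<close>

lemma simple_graph_reduced_adj:
  "simple_graph V adj \<Longrightarrow> simple_graph (V - W) (reduced_adj adj i0 j0)"
  by (auto simp: simple_graph_def reduced_adj_def Let_def)

lemma standard_SAUR_imp_SAUR:
  assumes "standard_SAUR V adj d S" "simple_graph V adj"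
  shows "SAUR V adj d S"
  using assms
proof (induction rule: standard_SAUR.induct)
  case (no_edge V adj d S)
  then show ?case
    by (auto simp: SAUR_def mat_adjoint_one)
next
  case (edge i0 V j0 adj d S' S)
  let ?r = "reduced_adj adj i0 j0" and ?g = "edge_group adj i0 j0"
  \<comment> \<open>Extending \<open>S'\<close> by the identity to \<open>i0\<close> and
    \<open>j0\<close> removes the special cases: the formula "Pauli matrix of the group tensored
    with \<open>T i\<close>" then holds at every vertex.\<close>
  define T where "T i = (if i \<in> {i0, j0} then 1\<^sub>m d else S' i)" for i
  have irr: "\<not> adj i i" if "i \<in> V" for i
    using edge.prems that by (auto simp: simple_graph_def)
  have sym: "adj i j \<longleftrightarrow> adj j i" if "i \<in> V" "j \<in> V" for i j
    using edge.prems that by (auto simp: simple_graph_def)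
  have S': "SAUR (V - {i0, j0}) ?r d S'"
    using edge.IH simple_graph_reduced_adj[OF edge.prems] by blast
  \<comment> \<open>\<open>i0\<close> lies in group 1 and is adjacent to exactly groups 2 and 3,
    where its adjacency is reversed; \<open>j0\<close> lies in group 3 and is adjacent to exactly
    groups 1 and 2. Reversal thus deletes all their edges.\<close>
  have isolated: "\<not> ?r i j" if "i \<in> V" "j \<in> V" "i \<in> {i0, j0} \<or> j \<in> {i0, j0}" for i j
    using that edge.hyps(1-3) irr sym
    by (auto simp: reduced_adj_def edge_group_def Let_def)
  have T: "SAUR V ?r d T"
    unfolding SAUR_iff_sign
  proof (intro conjI ballI)
    show "0 < d" using S' by (simp add: SAUR_def)
    fix i assume i: "i \<in> V"
    show Ti: "T i \<in> carrier_mat d d" "mat_adjoint (T i) = T i" "T i * T i = 1\<^sub>m d"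
      using S' i by (auto simp: T_def SAUR_def mat_adjoint_one)
    fix j assume j: "j \<in> V"
    have Tj: "T j \<in> carrier_mat d d"
      using S' j by (auto simp: T_def SAUR_def)
    show "T i * T j = (if ?r i j then - 1 else 1) \<cdot>\<^sub>m (T j * T i)"
    proof (cases "i \<in> {i0, j0} \<or> j \<in> {i0, j0}")
      case True
      then show ?thesis
        using isolated[OF i j True] Ti(1) Tj by (cases "i \<in> {i0, j0}") (simp_all add: T_def smult_one_mat)
    next
      case False
      then have "T i = S' i" "T j = S' j"
        by (simp_all add: T_def)
      moreover have "S' i * S' j = (if ?r i j then - 1 else 1) \<cdot>\<^sub>m (S' j * S' i)"
        using S' i j False unfolding SAUR_iff_sign by blast
      ultimately show ?thesis
        by (simp only:)
    qed
  qed
  have S_eq: "S i = pauli (?g i) \<otimes>\<^sub>m T i" if "i \<in> V" for i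
  proof -
    have "?g i0 = 1" "?g j0 = 3"
      using edge.hyps(1-3) irr sym by (auto simp: edge_group_def)
    then show ?thesis
      using that edge.hyps(5-7) by (auto simp: T_def)
  qed
  show ?case
    unfolding SAUR_iff_sign
  proof (intro conjI ballI)
    show "0 < 2 * d" using S' by (simp add: SAUR_def)
    fix i assume i: "i \<in> V"
    note Pi = pauli_self_adjoint[OF edge_group_less[of adj i0 j0 i]]
    have Ti: "T i \<in> carrier_mat d d" "mat_adjoint (T i) = T i" "T i * T i = 1\<^sub>m d"
      using T i by (auto simp: SAUR_def)
    show "S i \<in> carrier_mat (2 * d) (2 * d)"
      unfolding S_eq[OF i] using Pi(1) Ti(1) by simp
    show "mat_adjoint (S i) = S i"
      by (simp add: S_eq[OF i] mat_adjoint_tensor_mat[OF Pi(1) Ti(1)] Pi(2) Ti(2))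
    show "S i * S i = 1\<^sub>m (2 * d)"
      by (simp add: S_eq[OF i] tensor_mat_mult[OF Pi(1) Ti(1) Pi(1) Ti(1)] Pi(3) Ti(3) tensor_mat_one)
    fix j assume j: "j \<in> V"
    note Pj = pauli_self_adjoint[OF edge_group_less[of adj i0 j0 j]]
    have Tj: "T j \<in> carrier_mat d d"
      using T j by (auto simp: SAUR_def)
    \<comment> \<open>\<open>a\<close> is the sign contributed by the Pauli factors,
      \<open>b\<close> the sign contributed by the representation of the reduced graph.\<close>
    define a b :: complex
      where "a = (if ?g i \<in> {1, 2, 3} \<and> ?g j \<in> {1, 2, 3} \<and> ?g i \<noteq> ?g j then - 1 else 1)"
        and "b = (if ?r i j then - 1 else 1)"
    have "S i * S j = (pauli (?g i) * pauli (?g j)) \<otimes>\<^sub>m (T i * T j)"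
      by (simp add: S_eq i j tensor_mat_mult[OF Pi(1) Ti(1) Pj(1) Tj])
    also have "\<dots> = (a \<cdot>\<^sub>m (pauli (?g j) * pauli (?g i))) \<otimes>\<^sub>m (b \<cdot>\<^sub>m (T j * T i))"
      using T i j unfolding SAUR_iff_sign a_def b_def
      by (subst pauli_commute[OF edge_group_less edge_group_less]) metis
    also have "\<dots> = (a * b) \<cdot>\<^sub>m ((pauli (?g j) * pauli (?g i)) \<otimes>\<^sub>m (T j * T i))"
      using Pi(1) Pj(1) Ti(1) Tj by (intro tensor_mat_smult[of _ 2 2 _ d d]) auto
    also have "(pauli (?g j) * pauli (?g i)) \<otimes>\<^sub>m (T j * T i) = S j * S i"
      by (simp add: S_eq i j tensor_mat_mult[OF Pj(1) Tj Pi(1) Ti(1)])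
    \<comment> \<open>\<open>a\<close> is -1 exactly when the adjacency of \<open>i\<close> and
      \<open>j\<close> was reversed, so multiplying by it restores the sign belonging to
      \<open>adj\<close>.\<close>
    also have "a * b = (if adj i j then - 1 else 1)"
      by (auto simp: a_def b_def reduced_adj_def Let_def)
    finally show "S i * S j = (if adj i j then - 1 else 1) \<cdot>\<^sub>m (S j * S i)" .
  qed
qed

section \<open>Expectation values\<close>

lemma mat_trace_mult:
  assumes "A \<in> carrier_mat m n" "B \<in> carrier_mat n m"
  shows "mat_trace (A * B) = (\<Sum>i<m. \<Sum>j<n. A $$ (i, j) * B $$ (j, i))"
  using assms by (simp add: mat_trace_def scalar_prod_def atLeast0LessThan)

lemma expval_pure_state:
  assumes v: "v \<in> carrier_vec d" and A: "A \<in> carrier_mat d d"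
  shows "expval (pure_state v) A = Re ((A *\<^sub>v v) \<bullet>c v)"
proof -
  have "mat_trace (pure_state v * A) = (\<Sum>i<d. \<Sum>j<d. v $ i * cnj (v $ j) * A $$ (j, i))"
    using v A by (subst mat_trace_mult[of _ d d]) (auto simp: pure_state_def)
  also have "\<dots> = (\<Sum>j<d. \<Sum>i<d. v $ i * cnj (v $ j) * A $$ (j, i))"
    by (rule sum.swap)
  also have "\<dots> = (A *\<^sub>v v) \<bullet>c v"
    using v A by (simp add: scalar_prod_def atLeast0LessThan sum_distrib_left sum_distrib_right mult_ac)
  finally show ?thesis by (simp add: expval_def)
qed

lemma pure_state_in_states:
  assumes v: "v \<in> carrier_vec d" and norm: "v \<bullet>c v = 1"
  shows "pure_state v \<in> states d"
proof -
  have c: "pure_state v \<in> carrier_mat d d"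
    using v by (simp add: pure_state_def)
  have "mat_adjoint (pure_state v) = pure_state v"
    using v by (intro mat_adjoint_eqI[OF c]) (auto simp: pure_state_def)
  moreover have "0 \<le> Re ((pure_state v *\<^sub>v u) \<bullet>c u)" if u: "u \<in> carrier_vec d" for u
  proof -
    have "(pure_state v *\<^sub>v u) \<bullet>c u = (\<Sum>i<d. (\<Sum>j<d. v $ i * cnj (v $ j) * u $ j) * cnj (u $ i))"
      using u v by (simp add: scalar_prod_def pure_state_def atLeast0LessThan)
    \<comment> \<open>The quadratic form of a rank-one projection is the squared modulus of an inner
      product.\<close>
    also have "\<dots> = (\<Sum>i<d. v $ i * cnj (u $ i)) * cnj (\<Sum>i<d. v $ i * cnj (u $ i))"
      by (simp add: sum_distrib_left sum_distrib_right mult_ac)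
    finally show ?thesis
      by (simp only: complex_norm_square[symmetric] Re_complex_of_real zero_le_power2)
  qed
  moreover have "mat_trace (pure_state v) = 1"
    using v norm by (simp add: mat_trace_def pure_state_def scalar_prod_def atLeast0LessThan)
  ultimately show ?thesis
    using c by (simp add: states_def)
qed

text \<open>Self-adjointness turns the trace into a sum over the columns of \<open>A\<close> of the
  quadratic form of the state, and each term is nonnegative by the definition of
  \<open>states\<close>.\<close>

lemma state_trace_square_nonneg:
  assumes \<rho>: "\<rho> \<in> states d" and A: "A \<in> carrier_mat d d" "mat_adjoint A = A"
  shows "0 \<le> expval \<rho> (A * A)"
proof -
  have \<rho>c: "\<rho> \<in> carrier_mat d d" using \<rho> by (simp add: states_def)
  have "mat_trace (\<rho> * (A * A)) = (\<Sum>i<d. \<Sum>j<d. \<rho> $$ (i, j) * (\<Sum>k<d. A $$ (j, k) * A $$ (k, i)))"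
    using \<rho>c A by (subst mat_trace_mult[of _ d d]) (auto simp: scalar_prod_def atLeast0LessThan)
  also have "\<dots> = (\<Sum>i<d. \<Sum>j<d. \<Sum>k<d. \<rho> $$ (i, j) * A $$ (j, k) * cnj (A $$ (i, k)))"
    by (intro sum.cong refl) (simp add: sum_distrib_left mult.assoc self_adjoint_entry[OF A, symmetric])
  also have "\<dots> = (\<Sum>i<d. \<Sum>k<d. \<Sum>j<d. \<rho> $$ (i, j) * A $$ (j, k) * cnj (A $$ (i, k)))"
    by (intro sum.cong refl sum.swap)
  also have "\<dots> = (\<Sum>k<d. \<Sum>i<d. \<Sum>j<d. \<rho> $$ (i, j) * A $$ (j, k) * cnj (A $$ (i, k)))"
    by (rule sum.swap)
  also have "\<dots> = (\<Sum>k<d. (\<rho> *\<^sub>v col A k) \<bullet>c col A k)"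
    using \<rho>c A by (intro sum.cong refl) (simp add: scalar_prod_def atLeast0LessThan sum_distrib_right)
  finally have "expval \<rho> (A * A) = (\<Sum>k<d. Re ((\<rho> *\<^sub>v col A k) \<bullet>c col A k))"
    by (simp add: expval_def)
  also have "\<dots> \<ge> 0"
    using \<rho> A by (intro sum_nonneg) (auto simp: states_def)
  finally show ?thesis .
qed

lemma expval_one: "\<rho> \<in> states d \<Longrightarrow> expval \<rho> (1\<^sub>m d) = 1"
  by (auto simp: states_def expval_def)

lemma expval_add:
  assumes "\<rho> \<in> carrier_mat d d" "A \<in> carrier_mat d d" "B \<in> carrier_mat d d"
  shows "expval \<rho> (A + B) = expval \<rho> A + expval \<rho> B"
proof -
  have "mat_trace (\<rho> * (A + B)) = mat_trace (\<rho> * A) + mat_trace (\<rho> * B)"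
    using assms by (simp add: mat_trace_mult[of _ d d] sum.distrib distrib_left del: mult_add_distrib_mat)
  then show ?thesis by (simp add: expval_def)
qed

lemma expval_smult:
  assumes "\<rho> \<in> carrier_mat d d" "A \<in> carrier_mat d d"
  shows "expval \<rho> (complex_of_real c \<cdot>\<^sub>m A) = c * expval \<rho> A"
proof -
  have "mat_trace (\<rho> * (complex_of_real c \<cdot>\<^sub>m A)) = complex_of_real c * mat_trace (\<rho> * A)"
    using assms by (simp add: mat_trace_mult[of _ d d] sum_distrib_left mult_ac)
  then show ?thesis by (simp add: expval_def)
qed

text \<open>For \<open>c = 1\<close> and \<open>c = - 1\<close> the operator \<open>1 + c S\<close> is half of its own square, so its expectation
  is nonnegative.\<close>

lemma expval_reflection_bound:
  assumes \<rho>: "\<rho> \<in> states d" and S: "S \<in> carrier_mat d d" "mat_adjoint S = S" "S * S = 1\<^sub>m d"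
  shows "\<bar>expval \<rho> S\<bar> \<le> 1"
proof -
  have \<rho>c: "\<rho> \<in> carrier_mat d d" using \<rho> by (simp add: states_def)
  have bound: "0 \<le> 1 + c * expval \<rho> S" if c: "c * c = 1" for c :: real
  proof -
    define D where "D = 1\<^sub>m d + complex_of_real c \<cdot>\<^sub>m S"
    have D: "D \<in> carrier_mat d d" using S by (simp add: D_def)
    have "mat_adjoint D = D"
    proof (rule mat_adjoint_eqI[OF D])
      fix i j assume ij: "i < d" "j < d"
      then show "cnj (D $$ (j, i)) = D $$ (i, j)"
        using S(1) by (auto simp: D_def self_adjoint_entry[OF S(1,2), symmetric])
    qed
    then have "0 \<le> expval \<rho> (D * D)"
      by (rule state_trace_square_nonneg[OF \<rho> D])
    also have "D * D = D + D"
    proof -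
      have "complex_of_real c * complex_of_real c = 1"
        using c by (metis of_real_1 of_real_mult)
      then have "(complex_of_real c \<cdot>\<^sub>m S) * (complex_of_real c \<cdot>\<^sub>m S) = 1\<^sub>m d"
        using S by (simp add: mult_smult_assoc_mat[of _ d d _ d] mult_smult_distrib[of _ d d _ d]
            smult_smult_mat smult_one_mat)
      \<comment> \<open>Multiplication by \<open>c S\<close> swaps the two summands of
        \<open>D\<close>, because its square is the identity.\<close>
      then have "D * (complex_of_real c \<cdot>\<^sub>m S) = D"
        using S unfolding D_def
        by (subst add_mult_distrib_mat[of _ d d]) (auto intro: comm_add_mat)
      moreover have "D * D = D * 1\<^sub>m d + D * (complex_of_real c \<cdot>\<^sub>m S)"
        using S D by (subst (2) D_def) (rule mult_add_distrib_mat[of _ d d], auto)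
      ultimately show ?thesis using D by simp
    qed
    also have "expval \<rho> (D + D) = 2 * (1 + c * expval \<rho> S)"
      using S D \<rho>c \<rho> by (simp add: expval_add[OF \<rho>c D D] D_def expval_add[of _ d] expval_smult expval_one)
    finally show ?thesis by simp
  qed
  show ?thesis using bound[of 1] bound[of "- 1"] by (simp add: abs_le_iff)
qed

text \<open>Each summand is at most 1. A supremum of reals dominates the individual values only once
  the set is known to be bounded above.\<close>

lemma SAUR_bdd_above:
  assumes "SAUR V adj d S"
  shows "bdd_above ((\<lambda>\<rho>. \<Sum>i\<in>V. (expval \<rho> (S i))\<^sup>2) ` states d)"
proof (rule bdd_aboveI2)
  fix \<rho> assume "\<rho> \<in> states d"
  then have "(expval \<rho> (S i))\<^sup>2 \<le> 1" if "i \<in> V" for i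
    using assms that expval_reflection_bound[of \<rho> d "S i"] by (simp add: SAUR_def abs_square_le_1)
  then show "(\<Sum>i\<in>V. (expval \<rho> (S i))\<^sup>2) \<le> (\<Sum>i\<in>V. 1)"
    by (intro sum_mono) auto
qed

section \<open>The anti-heptagon\<close>

text \<open>On the representatives 1 to 7, congruence to 1 or -1 modulo 7 means being consecutive,
  apart from the wrap-around pair 1 and 7.\<close>

lemma anti_heptagon_iff:
  assumes "i \<in> {1..7}" "j \<in> {1..7}"
  shows "anti_heptagon i j \<longleftrightarrow> i \<noteq> j \<and> i \<noteq> Suc j \<and> j \<noteq> Suc i \<and> \<not> (i = 1 \<and> j = 7) \<and> \<not> (i = 7 \<and> j = 1)"
proof -
  have eq: "{1..7::nat} = {1, 2, 3, 4, 5, 6, 7}" by auto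
  show ?thesis
    using assms unfolding eq by (elim insertE emptyE; hypsubst) (simp_all add: anti_heptagon_def cong_def)
qed

lemma simple_graph_anti_heptagon: "simple_graph {1..7} anti_heptagon"
  unfolding simple_graph_def by (auto simp: anti_heptagon_iff)

text \<open>Independent sets of the complement are cliques of the 7-cycle: an edge such as
  \<open>{1, 2}\<close> is one, and the cycle contains no triangle.\<close>

lemma independence_number_anti_heptagon: "independence_number {1..7} anti_heptagon = 2"
  unfolding independence_number_def
proof (rule Max_eqI)
  have "{I. independent_set {1..7} anti_heptagon I} \<subseteq> Pow {1..7}"
    by (auto simp: independent_set_def)
  then show "finite (card ` {I. independent_set {1..7} anti_heptagon I})"
    by (intro finite_imageI) (rule finite_subset, auto)
  have "independent_set {1..7} anti_heptagon {1, 2}"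
    by (auto simp: independent_set_def anti_heptagon_iff)
  moreover have "card {1, 2 :: nat} = 2" by simp
  ultimately show "2 \<in> card ` {I. independent_set {1..7} anti_heptagon I}"
    by (metis image_eqI mem_Collect_eq)
next
  fix n assume "n \<in> card ` {I. independent_set {1..7} anti_heptagon I}"
  then obtain I where n: "n = card I" and I: "I \<subseteq> {1..7}" "\<And>i j. i \<in> I \<Longrightarrow> j \<in> I \<Longrightarrow> \<not> anti_heptagon i j"
    by (auto simp: independent_set_def)
  show "n \<le> 2"
  proof (rule ccontr)
    assume "\<not> n \<le> 2"
    then have "3 \<le> card I" using n by simp
    then obtain T where "T \<subseteq> I" "card T = 3" by (rule obtain_subset_with_card_n)
    then obtain a b c where abc: "a \<in> I" "b \<in> I" "c \<in> I" "a \<noteq> b" "a \<noteq> c" "b \<noteq> c"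
      by (auto simp: card_3_iff)
    then have "\<not> anti_heptagon a b" "\<not> anti_heptagon a c" "\<not> anti_heptagon b c"
      using I by auto
    moreover have "a \<in> {1..7}" "b \<in> {1..7}" "c \<in> {1..7}"
      using abc I by auto
    ultimately show False
      using abc(4-6) by (auto simp: anti_heptagon_iff)
  qed
qed

section \<open>The seven operators\<close>

lemma tensor_3_carrier:
  assumes "A \<in> carrier_mat 2 2" "B \<in> carrier_mat 2 2" "C \<in> carrier_mat 2 2"
  shows "A \<otimes>\<^sub>m B \<otimes>\<^sub>m C \<in> carrier_mat 8 8"
  using tensor_mat_carrier[OF assms(1) tensor_mat_carrier[OF assms(2,3)]] by simp

section \<open>Coordinates on the eight-dimensional space\<close>

lemma sum_less_8: "(\<Sum>k=0..<8. f k) = f 0 + f 1 + f 2 + f 3 + f 4 + f 5 + f 6 + f (7::nat)"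
  by (simp add: eval_nat_numeral)

lemma less_8_cases_iff: "(i::nat) < 8 \<longleftrightarrow> i = 0 \<or> i = 1 \<or> i = 2 \<or> i = 3 \<or> i = 4 \<or> i = 5 \<or> i = 6 \<or> i = 7"
  by presburger

definition vec_8 :: "complex \<Rightarrow> complex \<Rightarrow> complex \<Rightarrow> complex \<Rightarrow> complex \<Rightarrow> complex \<Rightarrow> complex \<Rightarrow> complex \<Rightarrow> complex vec"
  where "vec_8 a b c d e f g h = vec_of_list [a, b, c, d, e, f, g, h]"

lemma dim_vec_8 [simp]: "dim_vec (vec_8 a b c d e f g h) = 8"
  by (simp add: vec_8_def)

lemma vec_8_carrier [simp]: "vec_8 a b c d e f g h \<in> carrier_vec 8"
  by (rule carrier_vecI) simp

lemma vec_8_index: "vec_8 a b c d e f g h $ i = [a, b, c, d, e, f, g, h] ! i"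
  unfolding vec_8_def by (rule vec_of_list_index)

lemma vec_8_eqI:
  assumes "v \<in> carrier_vec 8" "v $ 0 = a" "v $ 1 = b" "v $ 2 = c" "v $ 3 = d"
    "v $ 4 = e" "v $ 5 = f" "v $ 6 = g" "v $ 7 = h"
  shows "v = vec_8 a b c d e f g h"
  using assms by (intro eq_vecI) (auto simp: vec_8_index less_8_cases_iff)

lemma vec_8_eq_iff:
  "vec_8 a b c d e f g h = vec_8 a' b' c' d' e' f' g' h' \<longleftrightarrow>
   a = a' \<and> b = b' \<and> c = c' \<and> d = d' \<and> e = e' \<and> f = f' \<and> g = g' \<and> h = h'"
  unfolding vec_8_def by (metis list.inject list_vec)

lemma add_vec_8:
  "vec_8 a b c d e f g h + vec_8 a' b' c' d' e' f' g' h' =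
   vec_8 (a + a') (b + b') (c + c') (d + d') (e + e') (f + f') (g + g') (h + h')"
  by (rule vec_8_eqI) (simp_all add: vec_8_index)

lemma smult_vec_8:
  "x \<cdot>\<^sub>v vec_8 a b c d e f g h =
   vec_8 (x * a) (x * b) (x * c) (x * d) (x * e) (x * f) (x * g) (x * h)"
  by (rule vec_8_eqI) (simp_all add: vec_8_index)

lemma scalar_prod_vec_8:
  "vec_8 a b c d e f g h \<bullet>c vec_8 a' b' c' d' e' f' g' h' =
   a * cnj a' + b * cnj b' + c * cnj c' + d * cnj d' + e * cnj e' + f * cnj f' + g * cnj g' + h * cnj h'"
  by (simp add: scalar_prod_def sum_less_8 vec_8_index)

text \<open>Positions are read in binary, with the first tensor factor as the most significant bit:
  \<open>u i j k\<close> is the entry at position \<open>4 * i + 2 * j + k\<close>, summed factor by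
  factor.\<close>

lemma tensor_3_mult_vec:
  fixes A B C :: "complex mat" and a b c d e f g h :: complex
  assumes A: "A \<in> carrier_mat 2 2" and B: "B \<in> carrier_mat 2 2" and C: "C \<in> carrier_mat 2 2"
  defines "u \<equiv> \<lambda>i j k.
    A $$ (i, 0) * (B $$ (j, 0) * (C $$ (k, 0) * a + C $$ (k, 1) * b) + B $$ (j, 1) * (C $$ (k, 0) * c + C $$ (k, 1) * d)) +
    A $$ (i, 1) * (B $$ (j, 0) * (C $$ (k, 0) * e + C $$ (k, 1) * f) + B $$ (j, 1) * (C $$ (k, 0) * g + C $$ (k, 1) * h))"
  shows "(A \<otimes>\<^sub>m B \<otimes>\<^sub>m C) *\<^sub>v vec_8 a b c d e f g h =
    vec_8 (u 0 0 0) (u 0 0 1) (u 0 1 0) (u 0 1 1) (u 1 0 0) (u 1 0 1) (u 1 1 0) (u 1 1 1)"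
proof -
  note BC = tensor_mat_carrier[OF B C]
  note ABC = tensor_3_carrier[OF A B C]
  have ABC_index: "(A \<otimes>\<^sub>m B \<otimes>\<^sub>m C) $$ (i, j) =
      A $$ (i div 4, j div 4) * (B $$ (i mod 4 div 2, j mod 4 div 2) * C $$ (i mod 4 mod 2, j mod 4 mod 2))"
    if "i < 8" "j < 8" for i j
    using that by (simp add: tensor_mat_index[OF A BC] tensor_mat_index[OF B C])
  have index: "((A \<otimes>\<^sub>m B \<otimes>\<^sub>m C) *\<^sub>v vec_8 a b c d e f g h) $ i =
      u (i div 4) (i mod 4 div 2) (i mod 4 mod 2)" if "i < 8" for i
  proof -
    have "((A \<otimes>\<^sub>m B \<otimes>\<^sub>m C) *\<^sub>v vec_8 a b c d e f g h) $ i =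
        (\<Sum>k=0..<8. (A \<otimes>\<^sub>m B \<otimes>\<^sub>m C) $$ (i, k) * vec_8 a b c d e f g h $ k)"
      using ABC that by (auto simp: scalar_prod_def intro!: sum.cong)
    also have "\<dots> = u (i div 4) (i mod 4 div 2) (i mod 4 mod 2)"
      using that by (simp add: sum_less_8 ABC_index vec_8_index u_def algebra_simps)
    finally show ?thesis .
  qed
  show ?thesis
    by (rule vec_8_eqI) (use ABC in \<open>simp_all add: index mult_mat_vec_carrier[OF ABC] del: index_mult_mat_vec\<close>)
qed

section \<open>The seven operators and their sum in coordinates\<close>

locale heptagon_operators =
  fixes S :: "nat \<Rightarrow> complex mat"
  assumes S1: "S 1 = pauli_Z \<otimes>\<^sub>m pauli_Z \<otimes>\<^sub>m 1\<^sub>m 2"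
    and S2: "S 2 = pauli_Z \<otimes>\<^sub>m 1\<^sub>m 2 \<otimes>\<^sub>m 1\<^sub>m 2"
    and S3: "S 3 = 1\<^sub>m 2 \<otimes>\<^sub>m pauli_X \<otimes>\<^sub>m 1\<^sub>m 2"
    and S4: "S 4 = pauli_X \<otimes>\<^sub>m 1\<^sub>m 2 \<otimes>\<^sub>m 1\<^sub>m 2"
    and S5: "S 5 = pauli_X \<otimes>\<^sub>m pauli_Z \<otimes>\<^sub>m pauli_X"
    and S6: "S 6 = pauli_Y \<otimes>\<^sub>m pauli_Z \<otimes>\<^sub>m pauli_Z"
    and S7: "S 7 = pauli_Y \<otimes>\<^sub>m pauli_Y \<otimes>\<^sub>m pauli_Y"
begin

lemma S_carrier:
  "S 1 \<in> carrier_mat 8 8" "S 2 \<in> carrier_mat 8 8" "S 3 \<in> carrier_mat 8 8" "S 4 \<in> carrier_mat 8 8"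
  "S 5 \<in> carrier_mat 8 8" "S 6 \<in> carrier_mat 8 8" "S 7 \<in> carrier_mat 8 8"
  unfolding S1 S2 S3 S4 S5 S6 S7 by (intro tensor_3_carrier; simp)+

text \<open>A tensor product of Pauli matrices and identities has one nonzero entry per row, so it
  permutes the coordinates up to factors 1, -1, \<open>\<i>\<close> and
  \<open>- \<i>\<close>.\<close>

lemma S_mult_vec:
  "S 1 *\<^sub>v vec_8 a b c d e f g h = vec_8 a b (- c) (- d) (- e) (- f) g h"
  "S 2 *\<^sub>v vec_8 a b c d e f g h = vec_8 a b c d (- e) (- f) (- g) (- h)"
  "S 3 *\<^sub>v vec_8 a b c d e f g h = vec_8 c d a b g h e f"
  "S 4 *\<^sub>v vec_8 a b c d e f g h = vec_8 e f g h a b c d"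
  "S 5 *\<^sub>v vec_8 a b c d e f g h = vec_8 f e (- h) (- g) b a (- d) (- c)"
  "S 6 *\<^sub>v vec_8 a b c d e f g h =
     vec_8 (- (\<i> * e)) (\<i> * f) (\<i> * g) (- (\<i> * h)) (\<i> * a) (- (\<i> * b)) (- (\<i> * c)) (\<i> * d)"
  "S 7 *\<^sub>v vec_8 a b c d e f g h =
     vec_8 (\<i> * h) (- (\<i> * g)) (- (\<i> * f)) (\<i> * e) (- (\<i> * d)) (\<i> * c) (\<i> * b) (- (\<i> * a))"
  unfolding S1 S2 S3 S4 S5 S6 S7 by (simp_all add: tensor_3_mult_vec)

definition H :: "complex mat" where
  "H = S 1 + S 2 + S 3 + S 4 + S 5 + S 6 + S 7"

lemma H_carrier: "H \<in> carrier_mat 8 8"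
  using S_carrier by (simp add: H_def)

lemma H_mult_vec:
  "H *\<^sub>v vec_8 a b c d e f g h = vec_8
    (2 * a + c + (1 - \<i>) * e + f + \<i> * h)
    (2 * b + d + e + (1 + \<i>) * f - \<i> * g)
    (a - \<i> * f + (1 + \<i>) * g - h)
    (b + \<i> * e - g + (1 - \<i>) * h)
    ((1 + \<i>) * a + b - \<i> * d - 2 * e + g)
    (a + (1 - \<i>) * b + \<i> * c - 2 * f + h)
    (\<i> * b + (1 - \<i>) * c - d + e)
    (- (\<i> * a) - c + (1 + \<i>) * d + f)"
proof -
  have v: "vec_8 a b c d e f g h \<in> carrier_vec 8"
    by simp
  show ?thesis
    using S_carrier
    by (simp add: H_def add_mult_distrib_mat_vec[OF _ _ v] S_mult_vec add_vec_8 algebra_simps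
        del: One_nat_def)
qed

section \<open>The explicit eigenvector\<close>

abbreviation rt2 :: complex where "rt2 \<equiv> complex_of_real (sqrt 2)"

lemma rt2_square: "rt2 * rt2 = 2"
  by (metis of_real_mult of_real_numeral real_sqrt_mult_self abs_numeral)

lemma rt2_square_left: "rt2 * (rt2 * x) = 2 * x"
  by (simp only: mult.assoc[symmetric] rt2_square)

text \<open>This is the point \<open>p = rt2\<close>, \<open>q = 1 + \<i>\<close> of the plane
  parametrised in \<open>H_cubic\<close>; these values solve the two equations of
  \<open>eigenvector_H_cases\<close> for \<open>k + 1 = - 2 * rt2\<close>.\<close>

definition w :: "complex vec" where
  "w = vec_8 rt2 (1 + \<i>) (- (\<i> * rt2)) (\<i> - 1) (- ((1 + rt2) * (1 + \<i>))) (- (rt2 + 2)) (1 + \<i>) rt2"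

lemma H_mult_w: "H *\<^sub>v w = (- (1 + 2 * rt2)) \<cdot>\<^sub>v w"
  unfolding w_def H_mult_vec smult_vec_8 vec_8_eq_iff
  by (simp add: algebra_simps rt2_square rt2_square_left)

lemma w_norm: "w \<bullet>c w = 24 + 8 * rt2"
  unfolding w_def scalar_prod_vec_8
  by (simp add: algebra_simps rt2_square rt2_square_left)

text \<open>Direct evaluation yields one common value. Seven times it equals
  \<open>- (1 + 2 * rt2)\<close> times the squared norm of \<open>w\<close>, in agreement with
  \<open>H_mult_w\<close>.\<close>

lemma S_expectation_w:
  assumes "i \<in> {1..7}"
  shows "(S i *\<^sub>v w) \<bullet>c w = - (8 * (1 + rt2))"
proof -
  have "i = 1 \<or> i = 2 \<or> i = 3 \<or> i = 4 \<or> i = 5 \<or> i = 6 \<or> i = 7"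
    using assms by auto
  then show ?thesis
    unfolding w_def
    by (elim disjE; hypsubst;
      simp only: S_mult_vec scalar_prod_vec_8;
      simp add: algebra_simps rt2_square rt2_square_left)
qed

text \<open>The image of \<open>H\<^sup>3 - H\<^sup>2 - 9 H + 1\<close> is the span of the eigenspaces for \<open>- 1 \<plusminus> 2 \<surd>2\<close>; the
  right-hand side below parametrises this plane by \<open>p\<close> and \<open>q\<close>.\<close>

lemma H_cubic:
  fixes a b c d e f g h
  defines "v \<equiv> vec_8 a b c d e f g h"
    and "p \<equiv> 4 * (- a - \<i> * c + (1 - \<i>) * e + f - h)"
    and "q \<equiv> 4 * (- b + \<i> * d + e + (1 + \<i>) * f - g)"
  shows "H *\<^sub>v (H *\<^sub>v (H *\<^sub>v v)) + (- 1) \<cdot>\<^sub>v (H *\<^sub>v (H *\<^sub>v v)) + (- 9) \<cdot>\<^sub>v (H *\<^sub>v v) + v =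
    vec_8 p q (- (\<i> * p)) (\<i> * q) (- ((1 + \<i>) * p) - q) (- p - (1 - \<i>) * q) q p"
  unfolding v_def H_mult_vec smult_vec_8 add_vec_8 vec_8_eq_iff p_def q_def
  by (intro conjI) (simp_all add: algebra_simps)

section \<open>Eigenvectors of the sum and its spectral radius\<close>

text \<open>The cubic in \<open>H\<close> acts on \<open>v\<close> as a nonzero scalar, so
  \<open>v\<close> lies in its image, the plane of \<open>H_cubic\<close>. There the eigenvalue
  equation reduces to a system for \<open>p\<close> and \<open>q\<close>.\<close>

lemma eigenvector_H_cases:
  assumes "eigenvector H v k" and b: "k ^ 3 - k ^ 2 - 9 * k + 1 \<noteq> 0"
  obtains p q where "v = vec_8 p q (- (\<i> * p)) (\<i> * q) (- ((1 + \<i>) * p) - q) (- p - (1 - \<i>) * q) q p"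
    "(k + 1) * p = - 2 * (1 - \<i>) * q" "(k + 1) * q = - 2 * (1 + \<i>) * p"
proof -
  have v: "v \<in> carrier_vec 8" and Hv: "H *\<^sub>v v = k \<cdot>\<^sub>v v"
    using assms(1) H_carrier by (auto simp: eigenvector_def)
  have HHv: "H *\<^sub>v (c \<cdot>\<^sub>v v) = (c * k) \<cdot>\<^sub>v v" for c
    using v H_carrier by (simp add: mult_mat_vec Hv smult_smult_assoc)
  have v8: "v = vec_8 (v $ 0) (v $ 1) (v $ 2) (v $ 3) (v $ 4) (v $ 5) (v $ 6) (v $ 7)"
    using v by (rule vec_8_eqI) simp_all
  let ?b = "k ^ 3 - k ^ 2 - 9 * k + 1"
  obtain p q where "H *\<^sub>v (H *\<^sub>v (H *\<^sub>v v)) + (- 1) \<cdot>\<^sub>v (H *\<^sub>v (H *\<^sub>v v)) + (- 9) \<cdot>\<^sub>v (H *\<^sub>v v) + v =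
    vec_8 p q (- (\<i> * p)) (\<i> * q) (- ((1 + \<i>) * p) - q) (- p - (1 - \<i>) * q) q p"
    using H_cubic[of "v $ 0" "v $ 1" "v $ 2" "v $ 3" "v $ 4" "v $ 5" "v $ 6" "v $ 7"]
    unfolding v8[symmetric] by blast
  moreover have "H *\<^sub>v (H *\<^sub>v (H *\<^sub>v v)) + (- 1) \<cdot>\<^sub>v (H *\<^sub>v (H *\<^sub>v v)) + (- 9) \<cdot>\<^sub>v (H *\<^sub>v v) + v = ?b \<cdot>\<^sub>v v"
    using v by (intro eq_vecI) (auto simp: Hv HHv algebra_simps power2_eq_square power3_eq_cube)
  ultimately have bv: "?b \<cdot>\<^sub>v v = vec_8 p q (- (\<i> * p)) (\<i> * q) (- ((1 + \<i>) * p) - q) (- p - (1 - \<i>) * q) q p"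
    by simp
  \<comment> \<open>Dividing by the value of the cubic moves the parametrisation from the image
    vector to \<open>v\<close> itself.\<close>
  define p' q' where "p' = inverse ?b * p" and "q' = inverse ?b * q"
  have "v = inverse ?b \<cdot>\<^sub>v (?b \<cdot>\<^sub>v v)"
    using v b by (intro eq_vecI) (simp_all add: mult.assoc[symmetric])
  also have "\<dots> = vec_8 p' q' (- (\<i> * p')) (\<i> * q') (- ((1 + \<i>) * p') - q') (- p' - (1 - \<i>) * q') q' p'"
    unfolding bv smult_vec_8 p'_def q'_def vec_8_eq_iff by (simp add: algebra_simps)
  finally have v_eq: "v = vec_8 p' q' (- (\<i> * p')) (\<i> * q') (- ((1 + \<i>) * p') - q') (- p' - (1 - \<i>) * q') q' p'" .
  from Hv have "(k + 1) * p' = - 2 * (1 - \<i>) * q'" "(k + 1) * q' = - 2 * (1 + \<i>) * p'"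
    unfolding v_eq H_mult_vec smult_vec_8 vec_8_eq_iff by (simp_all add: algebra_simps)
  with v_eq show ?thesis by (rule that)
qed

text \<open>For a root of modulus \<open>t\<close>, the triangle inequality gives
  \<open>t * (t * t - t - 9) \<le> 1\<close>. If \<open>t\<close> were at least 3.8, below
  \<open>1 + 2 * sqrt 2\<close>, then \<open>t * (t - 1)\<close> would be at least 10.64 and the
  left side at least 3.8.\<close>

lemma cubic_root_bound:
  fixes k :: complex
  assumes "k ^ 3 - k ^ 2 - 9 * k + 1 = 0"
  shows "cmod k < 1 + 2 * sqrt 2"
proof (rule ccontr)
  assume "\<not> ?thesis"
  moreover have "1.4 < sqrt 2" by (rule real_less_rsqrt) (simp add: power2_eq_square)
  ultimately have t: "3.8 \<le> cmod k" by simp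
  have "k ^ 3 = k ^ 2 + 9 * k - 1" using assms by (simp add: algebra_simps)
  then have "cmod k ^ 3 \<le> cmod (k ^ 2) + cmod (9 * k) + 1"
    by (metis norm_power norm_triangle_ineq norm_triangle_ineq4 norm_one order_trans add_right_mono)
  then have "cmod k * (cmod k * cmod k - cmod k - 9) \<le> 1"
    by (simp add: norm_power norm_mult power2_eq_square power3_eq_cube algebra_simps)
  moreover have "3.8 * 1 \<le> cmod k * (cmod k * cmod k - cmod k - 9)"
  proof (rule mult_mono)
    have "3.8 * 2.8 \<le> cmod k * (cmod k - 1)"
      using t by (intro mult_mono) auto
    then show "1 \<le> cmod k * cmod k - cmod k - 9" by (simp add: algebra_simps)
  qed (use t in auto)
  ultimately show False by simp
qed

text \<open>Outside the roots of the cubic, eliminating \<open>p\<close> or \<open>q\<close> leaves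
  \<open>(k + 1) * (k + 1) = 8\<close>. Excluding only smaller moduli lets the lemma both bound the
  spectral radius and determine the eigenspace that attains it.\<close>

lemma eigenvector_H_dominant:
  assumes "eigenvector H v k" "\<not> cmod k < 1 + 2 * sqrt 2"
  obtains t where "k = - (1 + 2 * rt2)" "v = t \<cdot>\<^sub>v w"
proof -
  have "k ^ 3 - k ^ 2 - 9 * k + 1 \<noteq> 0"
    using assms(2) cubic_root_bound by blast
  then obtain p q where v: "v = vec_8 p q (- (\<i> * p)) (\<i> * q) (- ((1 + \<i>) * p) - q) (- p - (1 - \<i>) * q) q p"
    and pq: "(k + 1) * p = - 2 * (1 - \<i>) * q" "(k + 1) * q = - 2 * (1 + \<i>) * p"
    using eigenvector_H_cases[OF assms(1)] by blast
  have "p \<noteq> 0 \<or> q \<noteq> 0"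
  proof (rule ccontr)
    assume "\<not> ?thesis"
    then have "v = 0\<^sub>v 8"
      unfolding v by (intro eq_vecI) (auto simp: vec_8_index less_8_cases_iff)
    then show False
      using assms(1) H_carrier by (simp add: eigenvector_def)
  qed
  moreover have "((k + 1) * (k + 1) - 8) * p = 0"
  proof -
    have "(k + 1) * ((k + 1) * p) = - 2 * (1 - \<i>) * ((k + 1) * q)"
      unfolding pq(1) by (simp add: mult_ac)
    also have "\<dots> = 8 * p"
      unfolding pq(2) by (simp add: algebra_simps)
    finally show ?thesis by (simp add: algebra_simps)
  qed
  moreover have "((k + 1) * (k + 1) - 8) * q = 0"
  proof -
    have "(k + 1) * ((k + 1) * q) = - 2 * (1 + \<i>) * ((k + 1) * p)"
      unfolding pq(2) by (simp add: mult_ac)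
    also have "\<dots> = 8 * q"
      unfolding pq(1) by (simp add: algebra_simps)
    finally show ?thesis by (simp add: algebra_simps)
  qed
  ultimately have "(k + 1) * (k + 1) - 8 = 0"
    by (metis mult_eq_0_iff)
  then have "(k + 1 - 2 * rt2) * (k + 1 + 2 * rt2) = 0"
    by (simp add: algebra_simps rt2_square)
  \<comment> \<open>The other square root gives an eigenvalue of modulus
    \<open>2 * sqrt 2 - 1\<close>, which is too small.\<close>
  moreover have "k + 1 - 2 * rt2 \<noteq> 0"
  proof
    assume "k + 1 - 2 * rt2 = 0"
    then have "k = of_real (2 * sqrt 2 - 1)" by (simp add: algebra_simps)
    then have "cmod k = 2 * sqrt 2 - 1"
      using real_sqrt_ge_one[of 2] by (simp only: norm_of_real) linarith
    then show False using assms(2) by simp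
  qed
  ultimately have "k + 1 + 2 * rt2 = 0"
    by (metis mult_eq_0_iff)
  then have k: "k = - (1 + 2 * rt2)"
    by (simp only: eq_neg_iff_add_eq_0 add.assoc)
  have "2 * (rt2 * q) = 2 * ((1 + \<i>) * p)"
    using pq(2) unfolding k by (simp add: algebra_simps)
  then have q: "rt2 * q = (1 + \<i>) * p" by simp
  have q': "q = (1 + \<i>) * (p / rt2)" and p': "p = rt2 * (p / rt2)"
    using q by (simp_all add: field_simps)
  \<comment> \<open>The first coordinates of \<open>v\<close> and \<open>w\<close> are
    \<open>p\<close> and \<open>rt2\<close>, which fixes the factor.\<close>
  define t where "t = p / rt2"
  have pt: "p = t * rt2" and qt: "q = t * (1 + \<i>)"
    using q' p' by (simp_all add: t_def)
  have "v = t \<cdot>\<^sub>v w"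
    unfolding v w_def smult_vec_8 vec_8_eq_iff pt qt by (simp add: algebra_simps)
  with k show ?thesis by (rule that)
qed

lemma eigenvector_w: "eigenvector H w (- (1 + 2 * rt2))"
proof -
  have "w \<noteq> 0\<^sub>v 8"
  proof
    assume "w = 0\<^sub>v 8"
    then have "w $ 0 = 0\<^sub>v 8 $ 0" by (rule arg_cong)
    then show False by (simp add: w_def vec_8_index)
  qed
  then show ?thesis
    using H_mult_w H_carrier by (simp add: eigenvector_def w_def)
qed

lemma cmod_dominant: "cmod (- (1 + 2 * rt2)) = 1 + 2 * sqrt 2"
proof -
  have "- (1 + 2 * rt2) = of_real (- (1 + 2 * sqrt 2))" by simp
  then show ?thesis
    using real_sqrt_ge_zero[of 2] by (simp only: norm_of_real) linarith
qed

lemma spectral_radius_H: "spectral_radius H = 1 + 2 * sqrt 2"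
proof (rule antisym)
  obtain k where "k \<in> spectrum H" "spectral_radius H = cmod k"
    using spectral_radius_mem_max(1)[OF H_carrier] by auto
  then obtain v where "eigenvector H v k" "spectral_radius H = cmod k"
    by (auto simp: spectrum_def eigenvalue_def)
  then show "spectral_radius H \<le> 1 + 2 * sqrt 2"
    using cmod_dominant by (metis eigenvector_H_dominant less_imp_le order_refl)
  have "- (1 + 2 * rt2) \<in> spectrum H"
    using eigenvector_w by (auto simp: spectrum_def eigenvalue_def)
  then have "cmod (- (1 + 2 * rt2)) \<le> spectral_radius H"
    using spectral_radius_mem_max(2)[OF H_carrier] by simp
  then show "1 + 2 * sqrt 2 \<le> spectral_radius H"
    by (simp only: cmod_dominant)
qed

lemma largest_eigenvector_H:
  assumes "largest_eigenvector H v"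
  obtains t where "v = t \<cdot>\<^sub>v w"
  using assms unfolding largest_eigenvector_def spectral_radius_H
  by (metis eigenvector_H_dominant less_irrefl)

lemma largest_eigenvector_smult_w:
  assumes "t \<noteq> 0"
  shows "largest_eigenvector H (t \<cdot>\<^sub>v w)"
proof -
  have "w = inverse t \<cdot>\<^sub>v (t \<cdot>\<^sub>v w)"
    using assms by (simp add: smult_smult_assoc)
  moreover have "inverse t \<cdot>\<^sub>v 0\<^sub>v 8 = (0\<^sub>v 8 :: complex vec)"
    by (rule eq_vecI) auto
  ultimately have "t \<cdot>\<^sub>v w \<noteq> 0\<^sub>v 8"
    using eigenvector_w H_carrier unfolding eigenvector_def by (metis carrier_matD(1))
  then have "eigenvector H (t \<cdot>\<^sub>v w) (- (1 + 2 * rt2))"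
    using eigenvector_w assms H_carrier
    by (auto simp: eigenvector_def mult_mat_vec smult_smult_assoc mult.commute)
  then show ?thesis
    unfolding largest_eigenvector_def spectral_radius_H using cmod_dominant by blast
qed

section \<open>The recursive construction for the anti-heptagon\<close>

text \<open>The edges (4, 2), (3, 1) and (5, 6) are removed in this order, each splitting off one
  tensor factor, until vertex 7 remains alone.\<close>

lemma standard_SAUR_heptagon: "standard_SAUR {1..7} anti_heptagon 8 S"
proof -
  have V0: "{1..7::nat} = {1, 2, 3, 4, 5, 6, 7}" by auto
  have V1: "{1, 2, 3, 4, 5, 6, 7::nat} - {4, 2} = {1, 3, 5, 6, 7}" by auto
  have V2: "{1, 3, 5, 6, 7::nat} - {3, 1} = {5, 6, 7}" by auto
  have V3: "{5, 6, 7::nat} - {5, 6} = {7}" by auto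
  define adj1 where "adj1 = reduced_adj anti_heptagon 4 2"
  define adj2 where "adj2 = reduced_adj adj1 3 1"
  define adj3 where "adj3 = reduced_adj adj2 5 6"
  \<comment> \<open>\<open>R1\<close> and \<open>R2\<close> keep the last two factors and the last
    factor of the operators on the vertices that are left.\<close>
  define R1 where "R1 i = (if i = 1 then pauli_Z \<otimes>\<^sub>m 1\<^sub>m 2 else if i = 3 then pauli_X \<otimes>\<^sub>m 1\<^sub>m 2
    else if i = 5 then pauli_Z \<otimes>\<^sub>m pauli_X else if i = 6 then pauli_Z \<otimes>\<^sub>m pauli_Z
    else pauli_Y \<otimes>\<^sub>m pauli_Y)" for i :: nat
  define R2 where "R2 i = (if i = 5 then pauli_X else if i = 6 then pauli_Z else pauli_Y)" for i :: nat
  have ah: "anti_heptagon i j \<longleftrightarrow> i \<noteq> j \<and> i \<noteq> Suc j \<and> j \<noteq> Suc i \<and> \<not> (i = 1 \<and> j = 7) \<and> \<not> (i = 7 \<and> j = 1)"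
    if "1 \<le> i" "i \<le> 7" "1 \<le> j" "j \<le> 7" for i j
    using that by (intro anti_heptagon_iff) auto
  note adj = adj3_def adj2_def adj1_def reduced_adj_def edge_group_def ah Let_def
  \<comment> \<open>The recursion ends in dimension 1, so three edges give dimension 8.\<close>
  have "standard_SAUR {7} adj3 1 (\<lambda>_. 1\<^sub>m 1)"
    by (rule standard_SAUR.no_edge) (auto simp: adj)
  then have "standard_SAUR {5, 6, 7} adj2 (2 * 1) R2"
    by (intro standard_SAUR.edge[where ?i0.0 = 5 and ?j0.0 = 6 and S' = "\<lambda>_. 1\<^sub>m 1"])
       (simp_all add: V3 adj3_def[symmetric] R2_def tensor_mat_one_right, simp_all add: adj tensor_mat_one_right)
  then have "standard_SAUR {1, 3, 5, 6, 7} adj1 (2 * 2) R1"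
    by (intro standard_SAUR.edge[where ?i0.0 = 3 and ?j0.0 = 1 and S' = R2])
       (simp_all add: V2 adj2_def[symmetric] R1_def, simp_all add: adj R2_def)
  then have "standard_SAUR {1, 2, 3, 4, 5, 6, 7} anti_heptagon (2 * 4) S"
    by (intro standard_SAUR.edge[where ?i0.0 = 4 and ?j0.0 = 2 and S' = R1])
       (simp_all add: V1[unfolded One_nat_def] adj1_def[symmetric], simp_all add: adj R1_def S1[simplified] S2 S3 S4 S5 S6 S7 tensor_mat_one)
  then show ?thesis unfolding V0 by simp
qed

section \<open>Expectations in the largest eigenvector\<close>

text \<open>Since \<open>v\<close> is a multiple of \<open>w\<close>, normalisation determines the
  squared modulus of the factor, and its phase cancels.\<close>

lemma expval_largest_eigenvector:
  assumes "largest_eigenvector H v" "v \<bullet>c v = 1" "i \<in> {1..7}"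
  shows "expval (pure_state v) (S i) = - (1 + 2 * sqrt 2) / 7"
proof -
  obtain t where v: "v = t \<cdot>\<^sub>v w" using assms(1) by (rule largest_eigenvector_H)
  have w: "w \<in> carrier_vec 8" by (simp add: w_def)
  have Si: "S i \<in> carrier_mat 8 8"
  proof -
    have "i = 1 \<or> i = 2 \<or> i = 3 \<or> i = 4 \<or> i = 5 \<or> i = 6 \<or> i = 7"
      using assms(3) by auto
    then show ?thesis using S_carrier by metis
  qed
  have scale: "(t \<cdot>\<^sub>v u) \<bullet>c (t \<cdot>\<^sub>v w) = t * cnj t * (u \<bullet>c w)" if "u \<in> carrier_vec 8" for u
    using that w by (simp add: conjugate_smult_vec)
  define r where "r = (cmod t)\<^sup>2"
  have t: "t * cnj t = of_real r" unfolding r_def by (rule complex_norm_square[symmetric])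
  have "complex_of_real (r * (24 + 8 * sqrt 2)) = 1"
    using assms(2) unfolding v scale[OF w] w_norm t by simp
  then have r: "r * (24 + 8 * sqrt 2) = 1"
    by (metis of_real_eq_1_iff)
  have "(S i *\<^sub>v v) \<bullet>c v = of_real r * - (8 * (1 + rt2))"
    unfolding v mult_mat_vec[OF Si w] scale[OF mult_mat_vec_carrier[OF Si w]] S_expectation_w[OF assms(3)] t
    by simp
  then have "expval (pure_state v) (S i) = r * - (8 * (1 + sqrt 2))"
    using v w Si by (subst expval_pure_state[of _ 8]) auto
  \<comment> \<open>The rationalisation
    \<open>7 * 8 * (1 + sqrt 2) = (1 + 2 * sqrt 2) * (24 + 8 * sqrt 2)\<close>, arranged to expose
    the norm.\<close>
  also have "\<dots> = - (1 + 2 * sqrt 2) / 7 * (r * (24 + 8 * sqrt 2))"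
    by (simp add: field_simps)
  finally show ?thesis unfolding r by simp
qed

lemma sum_expval_square:
  assumes "largest_eigenvector H v" "v \<bullet>c v = 1"
  shows "(\<Sum>i = 1..7. (expval (pure_state v) (S i))\<^sup>2) = (9 + 4 * sqrt 2) / 7"
proof -
  have "(\<Sum>i = 1..7. (expval (pure_state v) (S i))\<^sup>2) = (\<Sum>i = 1..(7::nat). (- (1 + 2 * sqrt 2) / 7)\<^sup>2)"
    by (rule sum.cong[OF refl]) (simp only: expval_largest_eigenvector[OF assms])
  then show ?thesis by (simp add: power2_eq_square field_simps)
qed

text \<open>Normalising \<open>w\<close> shows that the claim about all unit largest eigenvectors is
  not vacuous, and supplies the state used against the conjecture.\<close>

lemma unit_largest_eigenvector: "\<exists>v. largest_eigenvector H v \<and> v \<bullet>c v = 1"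
proof -
  define r where "r = 24 + 8 * sqrt 2"
  have r: "0 < r" by (simp add: r_def add_pos_pos)
  define t where "t = complex_of_real (1 / sqrt r)"
  have w: "w \<in> carrier_vec 8" by (simp add: w_def)
  have "(t \<cdot>\<^sub>v w) \<bullet>c (t \<cdot>\<^sub>v w) = t * cnj t * (w \<bullet>c w)"
    using w by (simp add: conjugate_smult_vec)
  also have "w \<bullet>c w = of_real r" by (simp add: w_norm r_def)
  also have "t * cnj t * of_real r = of_real (1 / sqrt r * (1 / sqrt r) * r)"
    by (simp only: t_def complex_cnj_complex_of_real of_real_mult)
  also have "1 / sqrt r * (1 / sqrt r) * r = 1"
    using r by (simp add: field_simps)
  finally have "(t \<cdot>\<^sub>v w) \<bullet>c (t \<cdot>\<^sub>v w) = 1" by simp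
  moreover have "t \<noteq> 0" using r by (simp add: t_def)
  ultimately show ?thesis using largest_eigenvector_smult_w by blast
qed

end

theorem mainTheorem3:
  fixes S :: "nat \<Rightarrow> complex mat"
  assumes "S 1 = pauli_Z \<otimes>\<^sub>m pauli_Z \<otimes>\<^sub>m 1\<^sub>m 2"
    and "S 2 = pauli_Z \<otimes>\<^sub>m 1\<^sub>m 2 \<otimes>\<^sub>m 1\<^sub>m 2"
    and "S 3 = 1\<^sub>m 2 \<otimes>\<^sub>m pauli_X \<otimes>\<^sub>m 1\<^sub>m 2"
    and "S 4 = pauli_X \<otimes>\<^sub>m 1\<^sub>m 2 \<otimes>\<^sub>m 1\<^sub>m 2"
    and "S 5 = pauli_X \<otimes>\<^sub>m pauli_Z \<otimes>\<^sub>m pauli_X"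
    and "S 6 = pauli_Y \<otimes>\<^sub>m pauli_Z \<otimes>\<^sub>m pauli_Z"
    and "S 7 = pauli_Y \<otimes>\<^sub>m pauli_Y \<otimes>\<^sub>m pauli_Y"
  shows
    "simple_graph {1..7} anti_heptagon \<and>
     SAUR {1..7} anti_heptagon 8 S \<and>
     standard_SAUR {1..7} anti_heptagon 8 S \<and>
     independence_number {1..7} anti_heptagon = 2 \<and>
     (let H = S 1 + S 2 + S 3 + S 4 + S 5 + S 6 + S 7 in
        (\<exists>v. largest_eigenvector H v \<and> v \<bullet>c v = 1) \<and>
        (\<forall>v. largest_eigenvector H v \<and> v \<bullet>c v = 1 \<longrightarrow>
           pure_state v \<in> states 8 \<and>
           (\<Sum>i = 1..7. (expval (pure_state v) (S i))\<^sup>2) = (9 + 4 * sqrt 2) / 7)) \<and>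
     \<bar>(9 + 4 * sqrt 2) / 7 - 2.09384\<bar> < (0.000005 :: real) \<and>
     (9 + 4 * sqrt 2) / 7 > (2 :: real) \<and>
     (SUP \<rho>\<in>states 8. \<Sum>i = 1..7. (expval \<rho> (S i))\<^sup>2)
       > real (independence_number {1..7} anti_heptagon) \<and>
     \<not> (\<forall>(V :: nat set) adj d T. simple_graph V adj \<and> SAUR V adj d T \<longrightarrow>
          (SUP \<rho>\<in>states d. \<Sum>i\<in>V. (expval \<rho> (T i))\<^sup>2) = real (independence_number V adj))"
proof -
  interpret heptagon_operators S
    by unfold_locales fact+
  have SAUR: "SAUR {1..7} anti_heptagon 8 S"
    using standard_SAUR_heptagon simple_graph_anti_heptagon by (rule standard_SAUR_imp_SAUR)
  have state: "pure_state v \<in> states 8" if "largest_eigenvector H v" "v \<bullet>c v = 1" for v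
    using that H_carrier
    by (intro pure_state_in_states) (auto simp: largest_eigenvector_def eigenvector_def)
  \<comment> \<open>Six decimals are taken because the lower bound 1.41421 would miss the tolerance
    0.000005.\<close>
  have sqrt2: "1.414213 < sqrt 2"
    by (rule real_less_rsqrt) (simp add: power2_eq_square)
  moreover have "sqrt 2 < 1.414214"
    by (rule real_less_lsqrt) (simp_all add: power2_eq_square)
  ultimately have approx: "\<bar>(9 + 4 * sqrt 2) / 7 - 2.09384\<bar> < (0.000005 :: real)"
    by (simp add: abs_less_iff)
  have gt2: "(9 + 4 * sqrt 2) / 7 > 2"
    using sqrt2 by simp
  obtain v where v: "largest_eigenvector H v" "v \<bullet>c v = 1"
    using unit_largest_eigenvector by blast
  \<comment> \<open>A single state already bounds the supremum from below, and this suffices to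
    exceed the independence number.\<close>
  have "(9 + 4 * sqrt 2) / 7 \<le> (SUP \<rho>\<in>states 8. \<Sum>i = 1..7. (expval \<rho> (S i))\<^sup>2)"
    unfolding sum_expval_square[OF v, symmetric]
    by (rule cSUP_upper[OF state[OF v] SAUR_bdd_above[OF SAUR]])
  then have sup: "(SUP \<rho>\<in>states 8. \<Sum>i = 1..7. (expval \<rho> (S i))\<^sup>2)
      > real (independence_number {1..7} anti_heptagon)"
    using gt2 unfolding independence_number_anti_heptagon by simp
  \<comment> \<open>The conjectured equality fails for the anti-heptagon with \<open>d = 8\<close>
    and \<open>T = S\<close>, where the supremum is strictly larger.\<close>
  show ?thesis
    unfolding Let_def H_def[symmetric]
    using simple_graph_anti_heptagon SAUR standard_SAUR_heptagon independence_number_anti_heptagon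
      unit_largest_eigenvector state sum_expval_square approx gt2 sup
    by (metis less_irrefl)
qed

end
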